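(* For $n\ge 0$ let $B_{n+2}$, with generators $\sigma_{-1},\sigma_0,\dots,\sigma_{n-1}$, act on $F(S^1)_{n+1}$ as described in the context. Then, for all $-1\le k\le n-1$ and $0\le j\le n+1$, the following identities of maps hold (composition being read right to left): $$d_j\sigma_k=\begin{cases}\sigma_{k-1}d_j & j\le k,\\ d_{k+2} & j=k+1,\\ d_{k+1} & j=k+2,\\ \sigma_kd_j & j>k+2,\end{cases}\qquad s_j\sigma_k=\begin{cases}\sigma_{k+1}s_j & j\le k,\\ \sigma_{k+1}\circ\sigma_k\circ s_{k+2} & j=k+1,\\ \sigma_k\circ\sigma_{k+1}\circ s_{k+1} & j=k+2,\\ \sigma_ks_j & j>k+2.\end{cases}$$
   Context: $F(S^1)$ is Milnor's construction on the simplicial circle $S^1$, in the following presentation: $F(S^1)_0$ is trivial and, for $n\ge0$, $F(S^1)_{n+1}=F(y_0,\dots,y_n)$ is the free group on $y_0,\dots,y_n$. In each $F(S^1)_{m}$ ($m\ge 1$) put $y_{-1}=(y_0y_1\cdots y_{m-1})^{-1}$. The faces and degeneracies on $F(S^1)_{n+1}$ ($0\le j\le n+1$) are the group homomorphisms given by $d_jy_k=y_{k-1}$ if $j\le k$, $d_jy_k=1$ if $j=k+1$, $d_jy_k=y_k$ if $j>k+1$; and $s_jy_k=y_{k+1}$ if $j\le k$, $s_jy_k=y_ky_{k+1}$ if $j=k+1$, $s_jy_k=y_k$ if $j>k+1$. Automorphisms $\sigma_k$ of $F(S^1)_{n+1}$: for $0\le k\le n-1$, $\sigma_k(y_k)=y_{k+1}$,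 $\sigma_k(y_{k+1})=y_{k+1}^{-1}y_ky_{k+1}$, and $\sigma_k(y_j)=y_j$ for $j\neq k,k+1$. Moreover $\sigma_{-1}(y_0)=y_0^{-1}y_{-1}y_0=y_0^{-1}y_n^{-1}\cdots y_1^{-1}$ and $\sigma_{-1}(y_j)=y_j$ for $j>0$. These automorphisms define an action of the braid group $B_{n+2}$ on $F(S^1)_{n+1}$. *)

theory Defs
  imports "HOL-Algebra.Group_Action"
begin

section \<open>Free groups\<close>

text \<open>
  The letter \<open>(a, True)\<close> stands for the generator \<open>a\<close>, and \<open>(a, False)\<close> for its inverse.
\<close>

type_synonym 'a word = "('a \<times> bool) list"

definition reduced :: "'a word \<Rightarrow> bool"
  where "reduced = successively (\<lambda>l l'. \<not> (fst l = fst l' \<and> snd l \<noteq> snd l'))"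

definition cons_reduce :: "'a \<times> bool \<Rightarrow> 'a word \<Rightarrow> 'a word"
  where "cons_reduce l w =
    (case w of [] \<Rightarrow> [l]
     | l' # w' \<Rightarrow> if fst l = fst l' \<and> snd l \<noteq> snd l' then w' else l # w)"

text \<open>
  If \<open>v\<close> is reduced, then \<open>foldr cons_reduce u v\<close> is the reduced form of the concatenation
  \<open>u @ v\<close>.
\<close>

definition free_group :: "'a set \<Rightarrow> 'a word monoid"
  where "free_group S =
    \<lparr>carrier = {w. fst ` set w \<subseteq> S \<and> reduced w},
     mult = foldr cons_reduce,
     one = []\<rparr>"

definition free_gen :: "'a \<Rightarrow> 'a word"
  where "free_gen a = [(a, True)]"

text \<open>The homomorphism out of a free group with prescribed values on the generators.\<close>

definition free_lift :: "('b, 'c) monoid_scheme \<Rightarrow> ('a \<Rightarrow> 'b) \<Rightarrow> 'a word \<Rightarrow> 'b"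
  where "free_lift G f w =
    foldr (\<lambda>l g. (if snd l then f (fst l) else inv\<^bsub>G\<^esub> f (fst l)) \<otimes>\<^bsub>G\<^esub> g) w \<one>\<^bsub>G\<^esub>"

section \<open>Braid groups\<close>

definition normal_closure :: "('a, 'b) monoid_scheme \<Rightarrow> 'a set \<Rightarrow> 'a set"
  where "normal_closure G R = \<Inter>{N. N \<lhd> G \<and> R \<subseteq> N}"

text \<open>
  The \<open>p - 1\<close> Artin generators of the braid group on \<open>p\<close> strands are numbered from \<open>-1\<close> to
  \<open>p - 3\<close>.
\<close>

definition braid_index :: "nat \<Rightarrow> int set"
  where "braid_index p = {- 1..int p - 3}"

definition braid_relators :: "nat \<Rightarrow> int word set"
  where "braid_relators p = (let F = free_group (braid_index p) in
      {(free_gen i \<otimes>\<^bsub>F\<^esub> free_gen j) \<otimes>\<^bsub>F\<^esub> inv\<^bsub>F\<^esub> (free_gen j \<otimes>\<^bsub>F\<^esub> free_gen i) | i j.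
         i \<in> braid_index p \<and> j \<in> braid_index p \<and> \<bar>i - j\<bar> \<ge> 2}
    \<union> {(free_gen i \<otimes>\<^bsub>F\<^esub> free_gen (i + 1) \<otimes>\<^bsub>F\<^esub> free_gen i) \<otimes>\<^bsub>F\<^esub>
         inv\<^bsub>F\<^esub> (free_gen (i + 1) \<otimes>\<^bsub>F\<^esub> free_gen i \<otimes>\<^bsub>F\<^esub> free_gen (i + 1)) | i.
         i \<in> braid_index p \<and> i + 1 \<in> braid_index p})"

definition braid_group :: "nat \<Rightarrow> int word set monoid"
  where "braid_group p =
    free_group (braid_index p) Mod normal_closure (free_group (braid_index p)) (braid_relators p)"

definition braid_gen :: "nat \<Rightarrow> int \<Rightarrow> int word set"
  where "braid_gen p k =
    normal_closure (free_group (braid_index p)) (braid_relators p)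
      #>\<^bsub>free_group (braid_index p)\<^esub> free_gen k"

section \<open>Milnor's construction on the simplicial circle\<close>

text \<open>\<open>FS1 m\<close> is the group of \<open>m\<close>-simplices, free on \<open>y\<^sub>0, \<dots>, y\<^sub>m\<^sub>-\<^sub>1\<close>.\<close>

definition FS1 :: "nat \<Rightarrow> int word monoid"
  where "FS1 m = free_group {0..int m - 1}"

definition FS1_y :: "nat \<Rightarrow> int \<Rightarrow> int word"
  where "FS1_y m k =
    (if k = - 1
     then inv\<^bsub>FS1 m\<^esub> (foldr (\<lambda>i g. free_gen i \<otimes>\<^bsub>FS1 m\<^esub> g) [0..int m - 1] \<one>\<^bsub>FS1 m\<^esub>)
     else free_gen k)"

text \<open>\<open>FS1_face n j\<close> and \<open>FS1_degen n j\<close> have source \<open>FS1 (n + 1)\<close>.\<close>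

definition FS1_face :: "nat \<Rightarrow> int \<Rightarrow> int word \<Rightarrow> int word"
  where "FS1_face n j = free_lift (FS1 n)
    (\<lambda>k. if j \<le> k then FS1_y n (k - 1)
         else if j = k + 1 then \<one>\<^bsub>FS1 n\<^esub>
         else FS1_y n k)"

definition FS1_degen :: "nat \<Rightarrow> int \<Rightarrow> int word \<Rightarrow> int word"
  where "FS1_degen n j = free_lift (FS1 (n + 2))
    (\<lambda>k. if j \<le> k then FS1_y (n + 2) (k + 1)
         else if j = k + 1 then FS1_y (n + 2) k \<otimes>\<^bsub>FS1 (n + 2)\<^esub> FS1_y (n + 2) (k + 1)
         else FS1_y (n + 2) k)"

text \<open>
  Since \<open>i\<close> runs over \<open>0, \<dots>, m - 1\<close>, the first case below does not occur when \<open>k = -1\<close>; the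
  second one is then the formula for the image of \<open>y\<^sub>0\<close> in terms of \<open>y\<^sub>-\<^sub>1\<close>.
\<close>

definition FS1_sigma :: "nat \<Rightarrow> int \<Rightarrow> int word \<Rightarrow> int word"
  where "FS1_sigma m k = restrict (free_lift (FS1 m)
    (\<lambda>i. if i = k then FS1_y m (k + 1)
         else if i = k + 1
         then inv\<^bsub>FS1 m\<^esub> FS1_y m (k + 1) \<otimes>\<^bsub>FS1 m\<^esub> FS1_y m k \<otimes>\<^bsub>FS1 m\<^esub> FS1_y m (k + 1)
         else FS1_y m i)) (carrier (FS1 m))"

text \<open>
  The action of \<open>braid_group (m + 1)\<close> on \<open>FS1 m\<close>: the map induced on cosets by the homomorphism
  from the free group on the Artin generators to the automorphism group.
\<close>

definition braid_action :: "nat \<Rightarrow> int word set \<Rightarrow> int word \<Rightarrow> int word"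
  where "braid_action m \<beta> = the_elem (free_lift (AutoGroup (FS1 m)) (FS1_sigma m) ` \<beta>)"

section \<open>The universal property of free groups\<close>

abbreviation inv_letter :: "'a \<times> bool \<Rightarrow> 'a \<times> bool"
  where "inv_letter l \<equiv> (fst l, \<not> snd l)"

lemma reduced_Nil [simp]: "reduced []"
  by (simp add: reduced_def)

lemma reduced_Cons:
  "reduced (l # w) \<longleftrightarrow> reduced w \<and> (w = [] \<or> hd w \<noteq> inv_letter l)"
  by (cases w) (auto simp: reduced_def prod_eq_iff)

lemma cons_reduce_simps:
  "cons_reduce l [] = [l]"
  "cons_reduce l (l' # w) = (if l' = inv_letter l then w else l # l' # w)"
  by (auto simp: cons_reduce_def prod_eq_iff)

lemma reduced_cons_reduce: "reduced w \<Longrightarrow> reduced (cons_reduce l w)"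
  by (cases w) (auto simp: cons_reduce_simps reduced_Cons)

lemma set_cons_reduce: "set (cons_reduce l w) \<subseteq> insert l (set w)"
  by (cases w) (auto simp: cons_reduce_simps)

lemma cons_reduce_reduced: "reduced (l # w) \<Longrightarrow> cons_reduce l w = l # w"
  by (cases w) (auto simp: cons_reduce_simps reduced_Cons)

lemma cons_reduce_cancel:
  assumes "reduced w"
  shows "cons_reduce l (cons_reduce (inv_letter l) w) = w"
proof (cases w)
  case (Cons l' w')
  have "cons_reduce l w' = l # w'" if "l' = l"
    using assms Cons that by (intro cons_reduce_reduced) simp
  then show ?thesis
    using Cons by (cases "l' = l") (auto simp: cons_reduce_simps prod_eq_iff)
qed (simp add: cons_reduce_simps)

lemma reduced_foldr: "reduced v \<Longrightarrow> reduced (foldr cons_reduce u v)"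
  by (induction u) (auto intro: reduced_cons_reduce)

lemma set_foldr: "set (foldr cons_reduce u v) \<subseteq> set u \<union> set v"
  by (induction u) (use set_cons_reduce in fastforce)+

lemma foldr_cons_reduce:
  assumes "reduced w"
  shows "foldr cons_reduce (cons_reduce l v) w = cons_reduce l (foldr cons_reduce v w)"
proof (cases v)
  case (Cons l' v')
  then show ?thesis
    using cons_reduce_cancel[OF reduced_foldr[OF assms], of l v'] by (auto simp: cons_reduce_simps)
qed (auto simp: cons_reduce_simps)

lemma foldr_assoc:
  "reduced w \<Longrightarrow> foldr cons_reduce (foldr cons_reduce u v) w = foldr cons_reduce u (foldr cons_reduce v w)"
  by (induction u) (auto simp: foldr_cons_reduce)

lemma foldr_Nil: "reduced w \<Longrightarrow> foldr cons_reduce w [] = w"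
  by (induction w) (auto simp: reduced_Cons cons_reduce_reduced)

lemma foldr_inv: "reduced w \<Longrightarrow> foldr cons_reduce (rev (map inv_letter w)) w = []"
proof (induction w)
  case (Cons l w)
  then show ?case by (auto simp: reduced_Cons cons_reduce_simps)
qed simp

lemma group_free_group: "group (free_group S)"
proof (rule groupI)
  fix x y assume "x \<in> carrier (free_group S)" "y \<in> carrier (free_group S)"
  then show "x \<otimes>\<^bsub>free_group S\<^esub> y \<in> carrier (free_group S)"
    using set_foldr[of x y] by (fastforce simp: free_group_def reduced_foldr)
next
  fix x assume x: "x \<in> carrier (free_group S)"
  define y where "y = foldr cons_reduce (rev (map inv_letter x)) []"
  have "set y \<subseteq> inv_letter ` set x"
    using set_foldr[of "rev (map inv_letter x)" "[]"] by (simp add: y_def)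
  then have "y \<in> carrier (free_group S)"
    using x by (fastforce simp: free_group_def y_def reduced_foldr)
  moreover have "y \<otimes>\<^bsub>free_group S\<^esub> x = \<one>\<^bsub>free_group S\<^esub>"
    using x by (simp add: free_group_def y_def foldr_assoc foldr_inv)
  ultimately show "\<exists>y\<in>carrier (free_group S). y \<otimes>\<^bsub>free_group S\<^esub> x = \<one>\<^bsub>free_group S\<^esub>" by blast
qed (auto simp: free_group_def foldr_assoc)

lemma free_gen_closed: "a \<in> S \<Longrightarrow> free_gen a \<in> carrier (free_group S)"
  by (simp add: free_group_def free_gen_def reduced_Cons)

lemma free_group_Cons:
  assumes "l # w \<in> carrier (free_group S)"
  shows "fst l \<in> S" "w \<in> carrier (free_group S)"
    "l # w = (if snd l then free_gen (fst l) else inv\<^bsub>free_group S\<^esub> free_gen (fst l))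
      \<otimes>\<^bsub>free_group S\<^esub> w"
proof -
  interpret F: group "free_group S" by (rule group_free_group)
  show a: "fst l \<in> S" and w: "w \<in> carrier (free_group S)"
    using assms by (auto simp: free_group_def reduced_Cons)
  have "inv\<^bsub>free_group S\<^esub> free_gen (fst l) = [(fst l, False)]"
    using a by (intro F.inv_equality)
      (auto simp: free_group_def free_gen_def reduced_Cons cons_reduce_simps)
  then have "(if snd l then free_gen (fst l) else inv\<^bsub>free_group S\<^esub> free_gen (fst l)) = [l]"
    by (cases l) (auto simp: free_gen_def)
  then show "l # w = (if snd l then free_gen (fst l) else inv\<^bsub>free_group S\<^esub> free_gen (fst l))
      \<otimes>\<^bsub>free_group S\<^esub> w"
    using assms by (simp add: free_group_def cons_reduce_reduced)
qed

lemma free_group_hom_ext: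
  assumes "group H" "h \<in> hom (free_group S) H" "h' \<in> hom (free_group S) H"
    and eq: "\<And>a. a \<in> S \<Longrightarrow> h (free_gen a) = h' (free_gen a)"
    and "w \<in> carrier (free_group S)"
  shows "h w = h' w"
proof -
  interpret h: group_hom "free_group S" H h
    using assms by (simp add: group_hom_def group_hom_axioms_def group_free_group)
  interpret h': group_hom "free_group S" H h'
    using assms by (simp add: group_hom_def group_hom_axioms_def group_free_group)
  show ?thesis using \<open>w \<in> carrier (free_group S)\<close>
  proof (induction w)
    case Nil
    then show ?case using h.hom_one h'.hom_one by (simp add: free_group_def)
  next
    case (Cons l w)
    note l = free_group_Cons[OF Cons.prems]
    show ?case
      using l(1,2) Cons.IH eq[OF l(1)] free_gen_closed[OF l(1)]
      by (subst (1 2) l(3)) auto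
  qed
qed

lemma free_lift_closed:
  assumes "group G" "f \<in> S \<rightarrow> carrier G" "fst ` set w \<subseteq> S"
  shows "free_lift G f w \<in> carrier G"
proof -
  interpret G: group G by fact
  show ?thesis using assms(2,3) by (induction w) (auto simp: free_lift_def)
qed

lemma free_lift_cons_reduce:
  assumes "group G" "f \<in> S \<rightarrow> carrier G" "fst l \<in> S" "fst ` set w \<subseteq> S"
  shows "free_lift G f (cons_reduce l w) = free_lift G f (l # w)"
proof -
  interpret G: group G by fact
  show ?thesis
  proof (cases w)
    case (Cons l' w')
    have "free_lift G f w' \<in> carrier G" "f (fst l) \<in> carrier G"
      using assms Cons by (auto intro!: free_lift_closed[where S = S])
    then show ?thesis using Cons
      by (cases "snd l") (auto simp: cons_reduce_simps free_lift_def simp flip: G.m_assoc)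
  qed (simp add: cons_reduce_simps)
qed

lemma free_lift_hom:
  assumes "group G" "f \<in> S \<rightarrow> carrier G"
  shows "free_lift G f \<in> hom (free_group S) G"
proof (rule homI)
  interpret G: group G by fact
  fix u v assume uv: "u \<in> carrier (free_group S)" "v \<in> carrier (free_group S)"
  then have u: "fst ` set u \<subseteq> S" and v: "fst ` set v \<subseteq> S" by (auto simp: free_group_def)
  have "free_lift G f (foldr cons_reduce u v) = free_lift G f u \<otimes>\<^bsub>G\<^esub> free_lift G f v"
    using u
  proof (induction u)
    case Nil
    then show ?case using free_lift_closed[OF assms v] by (simp add: free_lift_def)
  next
    case (Cons l u)
    have "fst ` set (foldr cons_reduce u v) \<subseteq> S"
      using set_foldr[of u v] Cons.prems v by fastforce
    then have "free_lift G f (foldr cons_reduce (l # u) v) = free_lift G f (l # foldr cons_reduce u v)"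
      using free_lift_cons_reduce[OF assms] Cons.prems by simp
    also have "\<dots> = (if snd l then f (fst l) else inv\<^bsub>G\<^esub> f (fst l)) \<otimes>\<^bsub>G\<^esub>
        (free_lift G f u \<otimes>\<^bsub>G\<^esub> free_lift G f v)"
      using Cons by (simp add: free_lift_def)
    also have "\<dots> = free_lift G f (l # u) \<otimes>\<^bsub>G\<^esub> free_lift G f v"
    proof -
      have "f (fst l) \<in> carrier G" "free_lift G f u \<in> carrier G" "free_lift G f v \<in> carrier G"
        using Cons.prems assms free_lift_closed[OF assms] v by auto
      then show ?thesis by (simp add: free_lift_def G.m_assoc)
    qed
    finally show ?case .
  qed
  then show "free_lift G f (u \<otimes>\<^bsub>free_group S\<^esub> v) = free_lift G f u \<otimes>\<^bsub>G\<^esub> free_lift G f v"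
    by (simp add: free_group_def)
qed (use assms in \<open>auto simp: free_group_def intro: free_lift_closed\<close>)

lemma free_lift_gen:
  assumes "group G" "f a \<in> carrier G"
  shows "free_lift G f (free_gen a) = f a"
proof -
  interpret G: group G by fact
  show ?thesis using assms by (simp add: free_lift_def free_gen_def)
qed

lemma group_hom_free_lift:
  assumes "group G" "f \<in> S \<rightarrow> carrier G"
  shows "group_hom (free_group S) G (free_lift G f)"
  using assms by (simp add: group_hom_def group_hom_axioms_def group_free_group free_lift_hom)

section \<open>The face, degeneracy and braid operators are homomorphisms\<close>

lemma group_FS1: "group (FS1 m)"
  by (simp add: FS1_def group_free_group)

lemma FS1_gen_closed: "0 \<le> i \<Longrightarrow> i < int m \<Longrightarrow> free_gen i \<in> carrier (FS1 m)"
  by (simp add: FS1_def free_gen_closed)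

lemma FS1_y_nonneg: "0 \<le> i \<Longrightarrow> FS1_y m i = free_gen i"
  by (simp add: FS1_y_def)

lemma foldr_mult_closed:
  assumes "group G" "\<And>i. i \<in> set is \<Longrightarrow> f i \<in> carrier G"
  shows "foldr (\<lambda>i g. f i \<otimes>\<^bsub>G\<^esub> g) is \<one>\<^bsub>G\<^esub> \<in> carrier G"
proof -
  interpret G: group G by fact
  show ?thesis using assms(2) by (induction "is") auto
qed

lemma foldr_mult_append:
  assumes "group G" "\<And>i. i \<in> set is \<union> set js \<Longrightarrow> f i \<in> carrier G"
  shows "foldr (\<lambda>i g. f i \<otimes>\<^bsub>G\<^esub> g) (is @ js) \<one>\<^bsub>G\<^esub> =
    foldr (\<lambda>i g. f i \<otimes>\<^bsub>G\<^esub> g) is \<one>\<^bsub>G\<^esub> \<otimes>\<^bsub>G\<^esub> foldr (\<lambda>i g. f i \<otimes>\<^bsub>G\<^esub> g) js \<one>\<^bsub>G\<^esub>"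
proof -
  interpret G: group G by fact
  show ?thesis using assms(2)
    by (induction "is") (auto simp: G.m_assoc foldr_mult_closed[OF assms(1)])
qed

lemma foldr_mult_hom:
  assumes "group_hom G H h" "\<And>i. i \<in> set is \<Longrightarrow> f i \<in> carrier G"
  shows "h (foldr (\<lambda>i g. f i \<otimes>\<^bsub>G\<^esub> g) is \<one>\<^bsub>G\<^esub>) = foldr (\<lambda>i g. h (f i) \<otimes>\<^bsub>H\<^esub> g) is \<one>\<^bsub>H\<^esub>"
proof -
  interpret group_hom G H h by fact
  show ?thesis using assms(2)
    by (induction "is") (auto simp: foldr_mult_closed[OF G.group_axioms])
qed

lemma FS1_y_closed:
  assumes "- 1 \<le> i" "i < int m"
  shows "FS1_y m i \<in> carrier (FS1 m)"
proof -
  interpret F: group "FS1 m" by (rule group_FS1)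
  have "foldr (\<lambda>i g. free_gen i \<otimes>\<^bsub>FS1 m\<^esub> g) [0..int m - 1] \<one>\<^bsub>FS1 m\<^esub> \<in> carrier (FS1 m)"
    by (rule foldr_mult_closed) (auto simp: group_FS1 FS1_gen_closed)
  then show ?thesis using assms by (auto simp: FS1_y_def FS1_gen_closed)
qed

lemma FS1_y_zero: "FS1_y 0 (- 1) = \<one>\<^bsub>FS1 0\<^esub>"
proof -
  interpret F: group "FS1 0" by (rule group_FS1)
  show ?thesis by (simp add: FS1_y_def)
qed

lemma FS1_face_hom:
  assumes "0 \<le> j" "j \<le> int n + 1"
  shows "FS1_face n j \<in> hom (FS1 (n + 1)) (FS1 n)"
proof -
  interpret F: group "FS1 n" by (rule group_FS1)
  show ?thesis
    unfolding FS1_face_def FS1_def[of "n + 1"] using assms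
    by (intro free_lift_hom group_FS1) (auto intro!: FS1_y_closed)
qed

lemma FS1_degen_hom:
  assumes "0 \<le> j" "j \<le> int n + 1"
  shows "FS1_degen n j \<in> hom (FS1 (n + 1)) (FS1 (n + 2))"
proof -
  interpret F: group "FS1 (n + 2)" by (rule group_FS1)
  have Y: "FS1_y (n + 2) i \<in> carrier (FS1 (n + 2))" if "0 \<le> i" "i \<le> int n + 1" for i
    using that by (intro FS1_y_closed) auto
  show ?thesis
    unfolding FS1_degen_def FS1_def[of "n + 1"] using assms
    by (intro free_lift_hom group_FS1) (auto simp del: add_2_eq_Suc' intro!: Y F.m_closed)
qed

text \<open>The defining formula on the \<open>y\<^sub>i\<close> holds for \<open>i = -1\<close> as well.\<close>

lemma FS1_sigma_y:
  assumes k: "- 1 \<le> k" "k \<le> int m - 2"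
  shows "FS1_sigma m k \<in> hom (FS1 m) (FS1 m)"
    and "\<And>i. - 1 \<le> i \<Longrightarrow> i < int m \<Longrightarrow> FS1_sigma m k (FS1_y m i) =
      (if i = k then FS1_y m (k + 1)
       else if i = k + 1
       then inv\<^bsub>FS1 m\<^esub> FS1_y m (k + 1) \<otimes>\<^bsub>FS1 m\<^esub> FS1_y m k \<otimes>\<^bsub>FS1 m\<^esub> FS1_y m (k + 1)
       else FS1_y m i)" (is "\<And>i. _ \<Longrightarrow> _ \<Longrightarrow> _ = ?f i")
proof -
  let ?F = "FS1 m" and ?Y = "FS1_y m"
  interpret F: group ?F by (rule group_FS1)
  note Y = FS1_y_closed
  have f: "?f \<in> {0..int m - 1} \<rightarrow> carrier ?F"
    using k by (auto intro!: FS1_y_closed F.m_closed F.inv_closed)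
  interpret L: group_hom ?F ?F "free_lift ?F ?f"
    using group_hom_free_lift[OF group_FS1 f] by (simp add: FS1_def)
  have sigma: "FS1_sigma m k x = free_lift ?F ?f x" if "x \<in> carrier ?F" for x
    using that by (simp add: FS1_sigma_def)
  show hom: "FS1_sigma m k \<in> hom ?F ?F"
    using L.homh by (auto simp: hom_def sigma)
  interpret h: group_hom ?F ?F "FS1_sigma m k"
    using hom by (simp add: group_hom_def group_hom_axioms_def group_FS1)
  have gen: "FS1_sigma m k (free_gen i) = ?f i" if "0 \<le> i" "i < int m" for i
    using that free_lift_gen[OF group_FS1, of ?f i m] f
    by (simp only: sigma FS1_gen_closed Pi_iff) simp
  let ?p = "\<lambda>g is. foldr (\<lambda>i x. g i \<otimes>\<^bsub>?F\<^esub> x) is \<one>\<^bsub>?F\<^esub>"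
  have y_minus: "?Y (- 1) = inv\<^bsub>?F\<^esub> ?p free_gen [0..int m - 1]"
    by (simp add: FS1_y_def)
  have fixed: "?p ?f is = ?p free_gen is" if "set is \<subseteq> {0..} - {k, k + 1}" for "is"
    using that by (induction "is") (auto simp: FS1_y_nonneg)
  have img: "FS1_sigma m k (?p free_gen [0..int m - 1]) = ?p ?f [0..int m - 1]"
  proof -
    have "FS1_sigma m k (?p free_gen [0..int m - 1]) =
        ?p (\<lambda>i. FS1_sigma m k (free_gen i)) [0..int m - 1]"
      by (rule foldr_mult_hom) (auto intro: h.group_hom_axioms FS1_gen_closed)
    also have "\<dots> = ?p ?f [0..int m - 1]"
      by (rule foldr_cong) (auto simp: gen)
    finally show ?thesis .
  qed
  have minus: "FS1_sigma m k (?Y (- 1)) = ?f (- 1)"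
  proof (cases "k = - 1")
    case True
    have split: "[0..int m - 1] = 0 # [1..int m - 1]"
      using k True by (simp add: upto_rec1)
    define P where "P = ?p free_gen [1..int m - 1]"
    have P: "P \<in> carrier ?F"
      unfolding P_def by (rule foldr_mult_closed) (auto simp: group_FS1 FS1_gen_closed)
    have g0: "free_gen 0 \<in> carrier ?F" using k True by (intro FS1_gen_closed) auto
    have y: "?Y (- 1) = inv\<^bsub>?F\<^esub> (free_gen 0 \<otimes>\<^bsub>?F\<^esub> P)"
      by (simp add: y_minus split P_def)
    have p: "?p ?f [1..int m - 1] = P"
      unfolding P_def by (rule fixed) (use True in auto)
    have "?f 0 = inv\<^bsub>?F\<^esub> free_gen 0 \<otimes>\<^bsub>?F\<^esub> inv\<^bsub>?F\<^esub> (free_gen 0 \<otimes>\<^bsub>?F\<^esub> P) \<otimes>\<^bsub>?F\<^esub> free_gen 0"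
      using True by (simp add: y FS1_y_nonneg)
    then have "?p ?f [0..int m - 1] = inv\<^bsub>?F\<^esub> free_gen 0"
      unfolding split using P g0 by (simp add: p F.inv_mult_group F.m_assoc)
    then have "FS1_sigma m k (inv\<^bsub>?F\<^esub> ?p free_gen [0..int m - 1]) = free_gen 0"
      using img g0 foldr_mult_closed[OF group_FS1[of m], of "[0..int m - 1]" free_gen]
      by (simp add: FS1_gen_closed)
    then show ?thesis using True by (simp add: y_minus FS1_y_nonneg)
  next
    case False
    then have k0: "0 \<le> k" using k by simp
    have "[0..int m - 1] = [0..k - 1] @ [k..int m - 1]"
      using k k0 upto_split1[of 0 k "int m - 1"] by simp
    also have "[k..int m - 1] = k # (k + 1) # [k + 2..int m - 1]"
      using k by (simp add: upto_rec1 add.commute)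
    finally have split: "[0..int m - 1] = [0..k - 1] @ k # (k + 1) # [k + 2..int m - 1]" .
    define Q where "Q = ?p free_gen [k + 2..int m - 1]"
    have Q: "Q \<in> carrier ?F"
      unfolding Q_def using k0 by (intro foldr_mult_closed) (auto simp: group_FS1 FS1_gen_closed)
    have g: "free_gen k \<in> carrier ?F" "free_gen (k + 1) \<in> carrier ?F"
      using k k0 by (auto intro: FS1_gen_closed)
    have q: "?p ?f [k + 2..int m - 1] = Q"
      unfolding Q_def by (rule fixed) (use k0 in auto)
    have fc: "?f i \<in> carrier ?F" if "0 \<le> i" "i < int m" for i
      using f that by (simp add: Pi_iff)
    have "?p ?f [0..int m - 1] = ?p ?f [0..k - 1] \<otimes>\<^bsub>?F\<^esub> ?p ?f (k # (k + 1) # [k + 2..int m - 1])"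
      unfolding split using k k0 by (intro foldr_mult_append group_FS1 fc) auto
    also have "?p ?f [0..k - 1] = ?p free_gen [0..k - 1]"
      by (rule fixed) auto
    also have "?p ?f (k # (k + 1) # [k + 2..int m - 1]) =
        free_gen (k + 1) \<otimes>\<^bsub>?F\<^esub> (inv\<^bsub>?F\<^esub> free_gen (k + 1) \<otimes>\<^bsub>?F\<^esub> free_gen k \<otimes>\<^bsub>?F\<^esub> free_gen (k + 1) \<otimes>\<^bsub>?F\<^esub> Q)"
      using k0 by (simp add: q FS1_y_nonneg)
    also have "\<dots> = ?p free_gen (k # (k + 1) # [k + 2..int m - 1])"
      using g Q by (simp add: Q_def[symmetric] F.m_assoc F.inv_solve_left' flip: F.m_assoc)
    also have "?p free_gen [0..k - 1] \<otimes>\<^bsub>?F\<^esub> \<dots> = ?p free_gen [0..int m - 1]"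
      unfolding split using k k0
      by (intro foldr_mult_append[symmetric] group_FS1 FS1_gen_closed) auto
    finally have "?p ?f [0..int m - 1] = ?p free_gen [0..int m - 1]" .
    then show ?thesis
      using False k0 img foldr_mult_closed[OF group_FS1[of m], of "[0..int m - 1]" free_gen]
      by (simp add: y_minus FS1_gen_closed)
  qed
  show "FS1_sigma m k (?Y i) = ?f i" if "- 1 \<le> i" "i < int m" for i
  proof (cases "i = - 1")
    case False
    then show ?thesis using gen[of i] that by (simp add: FS1_y_nonneg[of i])
  qed (use minus in simp)
qed

section \<open>The action of the braid group\<close>

lemma (in group) mult_inv_cancel:
  assumes "x \<in> carrier G" "y \<in> carrier G"
  shows "x \<otimes> (inv x \<otimes> y) = y" "inv x \<otimes> (x \<otimes> y) = y"
  using assms by (simp_all flip: m_assoc)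

lemma FS1_hom_ext:
  assumes "h \<in> hom (FS1 m) (FS1 m)" "h' \<in> hom (FS1 m) (FS1 m)"
    and "\<And>i. 0 \<le> i \<Longrightarrow> i < int m \<Longrightarrow> h (FS1_y m i) = h' (FS1_y m i)"
    and "x \<in> carrier (FS1 m)"
  shows "h x = h' x"
  using assms free_group_hom_ext[of "FS1 m" h "{0..int m - 1}" h' x] group_FS1[of m]
  by (simp add: FS1_def FS1_y_nonneg)

lemma FS1_y_minus_split:
  assumes "0 < m"
  obtains P where "P \<in> carrier (FS1 m)"
    and "FS1_y m (- 1) = inv\<^bsub>FS1 m\<^esub> (FS1_y m 0 \<otimes>\<^bsub>FS1 m\<^esub> P)"
    and "\<forall>h\<in>hom (FS1 m) (FS1 m).
      (\<forall>i. 0 < i \<and> i < int m \<longrightarrow> h (FS1_y m i) = FS1_y m i) \<longrightarrow> h P = P"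
proof
  let ?F = "FS1 m"
  define P where "P = foldr (\<lambda>i x. free_gen i \<otimes>\<^bsub>?F\<^esub> x) [1..int m - 1] \<one>\<^bsub>?F\<^esub>"
  show "P \<in> carrier ?F"
    unfolding P_def by (rule foldr_mult_closed) (auto simp: group_FS1 FS1_gen_closed)
  show "FS1_y m (- 1) = inv\<^bsub>?F\<^esub> (FS1_y m 0 \<otimes>\<^bsub>?F\<^esub> P)"
    using assms by (simp add: FS1_y_def P_def upto_rec1)
  show "\<forall>h\<in>hom ?F ?F. (\<forall>i. 0 < i \<and> i < int m \<longrightarrow> h (FS1_y m i) = FS1_y m i) \<longrightarrow> h P = P"
  proof (intro ballI impI)
    fix h assume h: "h \<in> hom ?F ?F"
      and fixed: "\<forall>i. 0 < i \<and> i < int m \<longrightarrow> h (FS1_y m i) = FS1_y m i"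
    have "h P = foldr (\<lambda>i x. h (free_gen i) \<otimes>\<^bsub>?F\<^esub> x) [1..int m - 1] \<one>\<^bsub>?F\<^esub>"
      unfolding P_def using h
      by (intro foldr_mult_hom) (auto simp: group_hom_def group_hom_axioms_def group_FS1 FS1_gen_closed)
    also have "\<dots> = P"
      unfolding P_def by (rule foldr_cong) (use fixed in \<open>auto simp: FS1_y_nonneg\<close>)
    finally show "h P = P" .
  qed
qed

lemma FS1_sigma_auto:
  assumes k: "- 1 \<le> k" "k \<le> int m - 2"
  shows "FS1_sigma m k \<in> auto (FS1 m)"
proof -
  let ?F = "FS1 m" and ?Y = "FS1_y m" and ?s = "FS1_sigma m k"
  interpret F: group ?F by (rule group_FS1)
  have Y: "?Y i \<in> carrier ?F" if "- 1 \<le> i" "i < int m" for i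
    using that by (rule FS1_y_closed)
  have Yk: "?Y k \<in> carrier ?F" "?Y (k + 1) \<in> carrier ?F" using k by (auto intro: Y)
  let ?f = "\<lambda>i. if i = k then ?Y k \<otimes>\<^bsub>?F\<^esub> ?Y (k + 1) \<otimes>\<^bsub>?F\<^esub> inv\<^bsub>?F\<^esub> ?Y k
    else if i = k + 1 then ?Y k else ?Y i"
  define t where "t = free_lift ?F ?f"
  have f: "?f \<in> {0..int m - 1} \<rightarrow> carrier ?F" using Yk by (auto intro!: Y)
  interpret t: group_hom ?F ?F t
    using group_hom_free_lift[OF group_FS1 f] by (simp add: FS1_def t_def)
  interpret s: group_hom ?F ?F ?s
    using FS1_sigma_y(1)[OF k] by (simp add: group_hom_def group_hom_axioms_def group_FS1)
  note sy = FS1_sigma_y(2)[OF k]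
  have ty: "t (?Y i) = ?f i" if "0 \<le> i" "i < int m" for i
  proof -
    have "t (free_gen i) = ?f i"
      unfolding t_def using that by (intro free_lift_gen group_FS1 funcset_mem[OF f]) simp
    then show ?thesis using that by (simp only: FS1_y_nonneg[of i])
  qed
  have st: "?s (t x) = x" if "x \<in> carrier ?F" for x
  proof -
    have "(?s \<circ> t) x = id x"
    proof (rule FS1_hom_ext[OF _ _ _ that])
      show "?s \<circ> t \<in> hom ?F ?F" using s.homh t.homh by (rule hom_compose[rotated])
      show "id \<in> hom ?F ?F" by (auto simp: hom_def)
      fix i assume i: "0 \<le> i" "i < int m"
      show "(?s \<circ> t) (?Y i) = id (?Y i)"
        using i k Yk by (auto simp: ty sy F.m_assoc F.mult_inv_cancel)
    qed
    then show ?thesis by simp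
  qed
  have tyk: "t (?Y k) = ?Y k \<otimes>\<^bsub>?F\<^esub> ?Y (k + 1) \<otimes>\<^bsub>?F\<^esub> inv\<^bsub>?F\<^esub> ?Y k"
  proof (cases "k = - 1")
    case True
    then have m: "0 < m" using k by simp
    obtain P where P: "P \<in> carrier ?F" "?Y (- 1) = inv\<^bsub>?F\<^esub> (?Y 0 \<otimes>\<^bsub>?F\<^esub> P)"
      and fixed: "\<forall>h\<in>hom ?F ?F. (\<forall>i. 0 < i \<and> i < int m \<longrightarrow> h (?Y i) = ?Y i) \<longrightarrow> h P = P"
      by (rule FS1_y_minus_split[OF m])
    have tP: "t P = P"
      using fixed t.homh True ty by auto
    have Y0: "?Y 0 \<in> carrier ?F" and Ym: "?Y (- 1) \<in> carrier ?F" using m by (auto intro!: Y)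
    have "t (?Y (- 1)) = inv\<^bsub>?F\<^esub> (?Y (- 1) \<otimes>\<^bsub>?F\<^esub> P)"
      using P Y0 tP ty[of 0] True m by simp
    also have "\<dots> = inv\<^bsub>?F\<^esub> P \<otimes>\<^bsub>?F\<^esub> inv\<^bsub>?F\<^esub> ?Y (- 1)"
      using P(1) Ym by (simp add: F.inv_mult_group)
    also have "inv\<^bsub>?F\<^esub> P = ?Y (- 1) \<otimes>\<^bsub>?F\<^esub> ?Y 0"
      using P(1,2) Y0 by (simp add: F.inv_mult_group F.m_assoc)
    finally show ?thesis using True by simp
  next
    case False
    then show ?thesis using ty[of k] k by simp
  qed
  have ts: "t (?s x) = x" if "x \<in> carrier ?F" for x
  proof -
    have "(t \<circ> ?s) x = id x"
    proof (rule FS1_hom_ext[OF _ _ _ that])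
      show "t \<circ> ?s \<in> hom ?F ?F" using t.homh s.homh by (rule hom_compose[rotated])
      show "id \<in> hom ?F ?F" by (auto simp: hom_def)
      fix i assume i: "0 \<le> i" "i < int m"
      have tk1: "t (?Y (k + 1)) = ?Y k" using ty[of "k + 1"] k by simp
      show "(t \<circ> ?s) (?Y i) = id (?Y i)"
      proof -
        consider "i = k" | "i = k + 1" | "i \<noteq> k" "i \<noteq> k + 1" by blast
        then show ?thesis
        proof cases
          case 1
          then show ?thesis using i sy[of i] tk1 by simp
        next
          case 2
          then show ?thesis using i sy[of i] tk1 tyk Yk by (simp add: F.m_assoc F.mult_inv_cancel)
        next
          case 3
          then show ?thesis using i sy[of i] ty[of i] by simp
        qed
      qed
    qed
    then show ?thesis by simp
  qed
  have "bij_betw ?s (carrier ?F) (carrier ?F)"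
    by (rule bij_betw_byWitness[where f' = t]) (auto simp: st ts)
  moreover have "?s \<in> extensional (carrier ?F)" by (simp add: FS1_sigma_def)
  ultimately show ?thesis
    using s.homh by (simp add: auto_def Bij_def)
qed

lemma AutoGroup_carrier: "carrier (AutoGroup G) = auto G"
  by (simp add: AutoGroup_def)

lemma AutoGroup_mult:
  assumes "f \<in> auto G" "g \<in> auto G" "x \<in> carrier G"
  shows "(f \<otimes>\<^bsub>AutoGroup G\<^esub> g) x = f (g x)"
  using assms by (simp add: AutoGroup_def BijGroup_def auto_def compose_eq)

lemma AutoGroup_FS1_eqI:
  assumes "f \<in> auto (FS1 m)" "g \<in> auto (FS1 m)"
    and "\<And>i. 0 \<le> i \<Longrightarrow> i < int m \<Longrightarrow> f (FS1_y m i) = g (FS1_y m i)"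
  shows "f = g"
proof (rule extensionalityI[where A = "carrier (FS1 m)"])
  show "f \<in> extensional (carrier (FS1 m))" "g \<in> extensional (carrier (FS1 m))"
    using assms by (auto simp: auto_def Bij_def)
  show "f x = g x" if "x \<in> carrier (FS1 m)" for x
    using assms that by (intro FS1_hom_ext[of f m g x]) (auto simp: auto_def)
qed

lemma FS1_sigma_far:
  assumes "- 1 \<le> i" "i \<le> int m - 2" "- 1 \<le> j" "j \<le> int m - 2" "\<bar>i - j\<bar> \<ge> 2"
  shows "FS1_sigma m i \<otimes>\<^bsub>AutoGroup (FS1 m)\<^esub> FS1_sigma m j =
    FS1_sigma m j \<otimes>\<^bsub>AutoGroup (FS1 m)\<^esub> FS1_sigma m i"
proof -
  let ?F = "FS1 m" and ?A = "AutoGroup (FS1 m)" and ?Y = "FS1_y m"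
  interpret F: group ?F by (rule group_FS1)
  interpret A: group ?A by (rule F.AutoGroup)
  interpret i: group_hom ?F ?F "FS1_sigma m i"
    using FS1_sigma_y(1) assms by (simp add: group_hom_def group_hom_axioms_def group_FS1)
  interpret j: group_hom ?F ?F "FS1_sigma m j"
    using FS1_sigma_y(1) assms by (simp add: group_hom_def group_hom_axioms_def group_FS1)
  have si: "FS1_sigma m i \<in> auto ?F" and sj: "FS1_sigma m j \<in> auto ?F"
    using assms by (auto intro: FS1_sigma_auto)
  have Y: "?Y l \<in> carrier ?F" if "- 1 \<le> l" "l < int m" for l
    using that by (rule FS1_y_closed)
  have Yij: "?Y i \<in> carrier ?F" "?Y (i + 1) \<in> carrier ?F" "?Y j \<in> carrier ?F" "?Y (j + 1) \<in> carrier ?F"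
    using assms by (auto intro: Y)
  note yi = FS1_sigma_y(2)[OF assms(1,2)] and yj = FS1_sigma_y(2)[OF assms(3,4)]
  show ?thesis
  proof (rule AutoGroup_FS1_eqI)
    show "FS1_sigma m i \<otimes>\<^bsub>?A\<^esub> FS1_sigma m j \<in> auto ?F" "FS1_sigma m j \<otimes>\<^bsub>?A\<^esub> FS1_sigma m i \<in> auto ?F"
      using si sj A.m_closed by (simp_all add: AutoGroup_carrier)
    fix l assume l: "0 \<le> l" "l < int m"
    then show "(FS1_sigma m i \<otimes>\<^bsub>?A\<^esub> FS1_sigma m j) (?Y l) = (FS1_sigma m j \<otimes>\<^bsub>?A\<^esub> FS1_sigma m i) (?Y l)"
      using assms Yij by (auto simp: AutoGroup_mult si sj Y yi yj)
  qed
qed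

lemma FS1_sigma_braid:
  assumes "- 1 \<le> k" "k + 1 \<le> int m - 2"
  shows "FS1_sigma m k \<otimes>\<^bsub>AutoGroup (FS1 m)\<^esub> FS1_sigma m (k + 1) \<otimes>\<^bsub>AutoGroup (FS1 m)\<^esub> FS1_sigma m k =
    FS1_sigma m (k + 1) \<otimes>\<^bsub>AutoGroup (FS1 m)\<^esub> FS1_sigma m k \<otimes>\<^bsub>AutoGroup (FS1 m)\<^esub> FS1_sigma m (k + 1)"
proof -
  let ?F = "FS1 m" and ?A = "AutoGroup (FS1 m)" and ?Y = "FS1_y m"
  let ?s = "FS1_sigma m k" and ?t = "FS1_sigma m (k + 1)"
  interpret F: group ?F by (rule group_FS1)
  interpret A: group ?A by (rule F.AutoGroup)
  interpret s: group_hom ?F ?F ?s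
    using FS1_sigma_y(1) assms by (simp add: group_hom_def group_hom_axioms_def group_FS1)
  interpret t: group_hom ?F ?F ?t
    using FS1_sigma_y(1) assms by (simp add: group_hom_def group_hom_axioms_def group_FS1)
  have s: "?s \<in> auto ?F" and t: "?t \<in> auto ?F"
    using assms by (auto intro: FS1_sigma_auto)
  have st: "?s \<otimes>\<^bsub>?A\<^esub> ?t \<in> auto ?F" "?t \<otimes>\<^bsub>?A\<^esub> ?s \<in> auto ?F"
    using s t A.m_closed by (simp_all add: AutoGroup_carrier)
  have Y: "?Y l \<in> carrier ?F" if "- 1 \<le> l" "l < int m" for l
    using that by (rule FS1_y_closed)
  have Yk: "?Y k \<in> carrier ?F" "?Y (k + 1) \<in> carrier ?F" "?Y (k + 2) \<in> carrier ?F"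
    using assms by (auto intro: Y)
  have ys: "- 1 \<le> l \<Longrightarrow> l < int m \<Longrightarrow> ?s (?Y l) =
      (if l = k then ?Y (k + 1)
       else if l = k + 1 then inv\<^bsub>?F\<^esub> ?Y (k + 1) \<otimes>\<^bsub>?F\<^esub> ?Y k \<otimes>\<^bsub>?F\<^esub> ?Y (k + 1)
       else ?Y l)" for l
    using FS1_sigma_y(2)[of k m l] assms by simp
  have yt: "- 1 \<le> l \<Longrightarrow> l < int m \<Longrightarrow> ?t (?Y l) =
      (if l = k + 1 then ?Y (k + 2)
       else if l = k + 2 then inv\<^bsub>?F\<^esub> ?Y (k + 2) \<otimes>\<^bsub>?F\<^esub> ?Y (k + 1) \<otimes>\<^bsub>?F\<^esub> ?Y (k + 2)
       else ?Y l)" for l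
    using FS1_sigma_y(2)[of "k + 1" m l] assms by (simp add: add.assoc)
  show ?thesis
  proof (rule AutoGroup_FS1_eqI)
    show "?s \<otimes>\<^bsub>?A\<^esub> ?t \<otimes>\<^bsub>?A\<^esub> ?s \<in> auto ?F" "?t \<otimes>\<^bsub>?A\<^esub> ?s \<otimes>\<^bsub>?A\<^esub> ?t \<in> auto ?F"
      using s t A.m_closed by (simp_all add: AutoGroup_carrier)
    fix l assume l: "0 \<le> l" "l < int m"
    have eval: "(?s \<otimes>\<^bsub>?A\<^esub> ?t \<otimes>\<^bsub>?A\<^esub> ?s) (?Y l) = ?s (?t (?s (?Y l)))"
      "(?t \<otimes>\<^bsub>?A\<^esub> ?s \<otimes>\<^bsub>?A\<^esub> ?t) (?Y l) = ?t (?s (?t (?Y l)))"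
      using s t st Y l by (simp_all add: AutoGroup_mult)
    consider "l = k" | "l = k + 1" | "l = k + 2" | "l \<noteq> k" "l \<noteq> k + 1" "l \<noteq> k + 2" by blast
    then have "?s (?t (?s (?Y l))) = ?t (?s (?t (?Y l)))"
    proof cases
      case 1
      then show ?thesis using l assms by (simp add: ys yt)
    next
      case 2
      then show ?thesis using l assms Yk by (simp add: ys yt F.m_assoc F.mult_inv_cancel)
    next
      case 3
      then show ?thesis using l assms Yk
        by (simp add: ys yt F.m_assoc F.inv_mult_group F.mult_inv_cancel)
    next
      case 4
      then show ?thesis using l by (simp add: ys yt)
    qed
    then show "(?s \<otimes>\<^bsub>?A\<^esub> ?t \<otimes>\<^bsub>?A\<^esub> ?s) (?Y l) = (?t \<otimes>\<^bsub>?A\<^esub> ?s \<otimes>\<^bsub>?A\<^esub> ?t) (?Y l)"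
      by (simp add: eval)
  qed
qed

lemma normal_closure_subset:
  "N \<lhd> G \<Longrightarrow> R \<subseteq> N \<Longrightarrow> normal_closure G R \<subseteq> N"
  by (auto simp: normal_closure_def)

lemma normal_normal_closure:
  assumes "group G" "R \<subseteq> carrier G"
  shows "normal_closure G R \<lhd> G"
proof -
  interpret G: group G by fact
  have top: "carrier G \<lhd> G"
    by (rule G.normal_invI[OF G.subgroup_self]) auto
  show ?thesis unfolding normal_closure_def
  proof (rule G.normal_invI)
    show "subgroup (\<Inter>{N. N \<lhd> G \<and> R \<subseteq> N}) G"
      using top assms(2) by (intro G.subgroups_Inter) (auto intro: normal_imp_subgroup)
    show "x \<otimes>\<^bsub>G\<^esub> h \<otimes>\<^bsub>G\<^esub> inv\<^bsub>G\<^esub> x \<in> \<Inter>{N. N \<lhd> G \<and> R \<subseteq> N}"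
      if "x \<in> carrier G" "h \<in> \<Inter>{N. N \<lhd> G \<and> R \<subseteq> N}" for x h
      using that by (auto intro: normal.inv_op_closed2)
  qed
qed

lemma group_braid_group: "group (braid_group p)"
  and braid_relators_closed: "braid_relators p \<subseteq> carrier (free_group (braid_index p))"
proof -
  interpret F: group "free_group (braid_index p)" by (rule group_free_group)
  show "braid_relators p \<subseteq> carrier (free_group (braid_index p))"
    by (auto simp: braid_relators_def Let_def intro!: free_gen_closed F.m_closed F.inv_closed)
  then show "group (braid_group p)"
    unfolding braid_group_def by (intro normal.factorgroup_is_group normal_normal_closure group_free_group)
qed

lemma braid_action_coset:
  fixes m :: nat
  defines "S \<equiv> braid_index (m + 1)"
  assumes w: "w \<in> carrier (free_group S)"
  shows "braid_action m (normal_closure (free_group S) (braid_relators (m + 1)) #>\<^bsub>free_group S\<^esub> w) =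
    free_lift (AutoGroup (FS1 m)) (FS1_sigma m) w"
proof -
  let ?F = "free_group S" and ?A = "AutoGroup (FS1 m)" and ?h = "free_lift (AutoGroup (FS1 m)) (FS1_sigma m)"
  let ?N = "normal_closure ?F (braid_relators (m + 1))"
  interpret A: group ?A by (rule group.AutoGroup[OF group_FS1])
  have S: "i \<in> S \<longleftrightarrow> - 1 \<le> i \<and> i \<le> int m - 2" for i by (auto simp: S_def braid_index_def)
  have sigma: "FS1_sigma m \<in> S \<rightarrow> carrier ?A"
    by (auto simp: S AutoGroup_carrier intro: FS1_sigma_auto)
  interpret h: group_hom ?F ?A ?h
    by (rule group_hom_free_lift[OF A.group_axioms sigma])
  have gen: "free_gen i \<in> carrier ?F" "?h (free_gen i) = FS1_sigma m i" if "i \<in> S" for i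
    using that sigma by (auto intro!: free_gen_closed free_lift_gen A.group_axioms)
  have sc: "FS1_sigma m i \<in> carrier ?A" if "i \<in> S" for i using sigma that by auto
  have "braid_relators (m + 1) \<subseteq> kernel ?F ?A ?h"
  proof
    fix r assume "r \<in> braid_relators (m + 1)"
    then consider
      (far) i j where "i \<in> S" "j \<in> S" "\<bar>i - j\<bar> \<ge> 2"
        "r = (free_gen i \<otimes>\<^bsub>?F\<^esub> free_gen j) \<otimes>\<^bsub>?F\<^esub> inv\<^bsub>?F\<^esub> (free_gen j \<otimes>\<^bsub>?F\<^esub> free_gen i)"
    | (near) i where "i \<in> S" "i + 1 \<in> S"
        "r = (free_gen i \<otimes>\<^bsub>?F\<^esub> free_gen (i + 1) \<otimes>\<^bsub>?F\<^esub> free_gen i) \<otimes>\<^bsub>?F\<^esub>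
         inv\<^bsub>?F\<^esub> (free_gen (i + 1) \<otimes>\<^bsub>?F\<^esub> free_gen i \<otimes>\<^bsub>?F\<^esub> free_gen (i + 1))"
      by (auto simp: braid_relators_def Let_def S_def)
    then show "r \<in> kernel ?F ?A ?h"
    proof cases
      case far
      then show ?thesis
        using FS1_sigma_far[of i m j] S sc by (simp add: kernel_def gen)
    next
      case near
      then show ?thesis
        using FS1_sigma_braid[of i m] S[of i] S[of "i + 1"] sc by (simp add: kernel_def gen)
    qed
  qed
  then have ker: "?N \<subseteq> kernel ?F ?A ?h"
    by (intro normal_closure_subset h.normal_kernel)
  have "subgroup ?N ?F"
    using normal_normal_closure[OF group_free_group braid_relators_closed] normal_imp_subgroup
    unfolding S_def by blast
  then have "w \<in> ?N #>\<^bsub>?F\<^esub> w"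
    using w by (simp add: h.rcos_self)
  moreover have "?h x = ?h w" if "x \<in> ?N #>\<^bsub>?F\<^esub> w" for x
    using that ker w by (auto simp: r_coset_def kernel_def)
  ultimately have "?h ` (?N #>\<^bsub>?F\<^esub> w) = {?h w}" by blast
  then show ?thesis by (simp add: braid_action_def)
qed

theorem braid_action_gen:
  assumes "- 1 \<le> k" "k \<le> int m - 2"
  shows "braid_action m (braid_gen (m + 1) k) = FS1_sigma m k"
proof -
  have k: "k \<in> braid_index (m + 1)" using assms by (simp add: braid_index_def)
  have "FS1_sigma m k \<in> carrier (AutoGroup (FS1 m))"
    using assms by (simp add: AutoGroup_carrier FS1_sigma_auto)
  then show ?thesis unfolding braid_gen_def
    using braid_action_coset[OF free_gen_closed[OF k]]
      free_lift_gen[OF group.AutoGroup[OF group_FS1]] by simp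
qed

theorem braid_action_hom: "braid_action m \<in> hom (braid_group (m + 1)) (AutoGroup (FS1 m))"
proof -
  define p where "p = m + 1"
  let ?F = "free_group (braid_index p)"
  let ?N = "normal_closure ?F (braid_relators p)"
  let ?A = "AutoGroup (FS1 m)" and ?h = "free_lift (AutoGroup (FS1 m)) (FS1_sigma m)"
  have N: "?N \<lhd> ?F" by (intro normal_normal_closure group_free_group braid_relators_closed)
  interpret h: group_hom ?F ?A ?h
    by (rule group_hom_free_lift[OF group.AutoGroup[OF group_FS1]])
      (auto simp: AutoGroup_carrier braid_index_def p_def intro!: FS1_sigma_auto)
  have coset: "braid_action m (?N #>\<^bsub>?F\<^esub> w) = ?h w" if "w \<in> carrier ?F" for w
    using braid_action_coset[of w m] that by (simp add: p_def)
  have "braid_action m \<in> hom (?F Mod ?N) ?A"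
    by (rule homI) (auto simp: carrier_FactGroup coset normal.rcos_sum[OF N])
  then show ?thesis by (simp add: braid_group_def p_def)
qed

corollary braid_action_group_action:
  "group_action (braid_group (m + 1)) (carrier (FS1 m)) (braid_action m)"
proof -
  have "braid_action m \<in> hom (braid_group (m + 1)) (BijGroup (carrier (FS1 m)))"
    using braid_action_hom[of m] group.subgroup_auto[OF group_FS1, of m]
    by (auto simp: hom_def AutoGroup_def dest: subgroup.subset)
  then show ?thesis
    by (simp add: group_action_def group_hom_def group_hom_axioms_def group_BijGroup group_braid_group)
qed

end

theory Submission
  imports Defs
begin

text \<open>
  Both sides of every identity are homomorphisms out of the free group on \<open>y\<^sub>0, \<dots>, y\<^sub>n\<close>, so it is
  enough to compare them on these generators. There everything is an explicit word, but the case
  \<open>k = -1\<close> and the face \<open>d\<^sub>0\<close> bring in \<open>y\<^sub>-\<^sub>1 = (y\<^sub>0 \<cdots> y\<^sub>n)\<^sup>-\<^sup>1\<close>, which is not a generator. The point of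
  the proof is that the comparison can treat \<open>y\<^sub>-\<^sub>1\<close> as one more letter: the formulas that define \<open>d\<^sub>j\<close> and
  \<open>s\<^sub>j\<close> on \<open>y\<^sub>0, \<dots>, y\<^sub>n\<close> remain true on \<open>y\<^sub>-\<^sub>1\<close> (lemmas \<open>FS1_face_y\<close> and \<open>FS1_degen_y\<close>), as does
  the one for \<open>\<sigma>\<^sub>k\<close> (lemma \<open>FS1_sigma_y\<close>). Then the identities for \<open>k = -1\<close> are the same
  computation as for \<open>k \<ge> 0\<close>. If \<open>j \<le> k\<close> or \<open>j > k + 2\<close>, then \<open>d\<^sub>j\<close> and \<open>s\<^sub>j\<close> only shift the indices
  of the two letters \<open>y\<^sub>k\<close>, \<open>y\<^sub>k\<^sub>+\<^sub>1\<close> moved by \<open>\<sigma>\<^sub>k\<close>, both by the same amount, and the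
  image of every other letter \<open>y\<^sub>i\<close> avoids the shifted pair. If \<open>j = k + 1\<close> or \<open>j = k + 2\<close>, one of the
  two letters is deleted by \<open>d\<^sub>j\<close>, which leaves of \<open>\<sigma>\<^sub>k\<close> only a renumbering, or is replaced by a
  product of two letters by \<open>s\<^sub>j\<close>; the other one then has to cross both factors, which takes two
  braid generators.

  The formulas on \<open>y\<^sub>-\<^sub>1\<close> come from the partial products \<open>p\<^sub>r = y\<^sub>0 \<cdots> y\<^sub>r\<^sub>-\<^sub>1\<close>. For \<open>j > 0\<close> the maps
  \<open>d\<^sub>j\<close> and \<open>s\<^sub>j\<close> simply reindex them (\<open>d\<^sub>j\<close> identifies \<open>p\<^sub>j\<^sub>-\<^sub>1\<close> with \<open>p\<^sub>j\<close>, and \<open>s\<^sub>j\<close> skips \<open>p\<^sub>j\<close>), hence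
  send the full product to the full product. For \<open>j = 0\<close> the reindexing moves the base point,
  and this produces one extra factor on the left.
\<close>

section \<open>Partial products of the generators\<close>

definition FS1_prod :: "nat \<Rightarrow> nat \<Rightarrow> int word"
  where "FS1_prod m r = foldr (\<lambda>i g. free_gen i \<otimes>\<^bsub>FS1 m\<^esub> g) [0..int r - 1] \<one>\<^bsub>FS1 m\<^esub>"

lemma FS1_prod_closed: "r \<le> m \<Longrightarrow> FS1_prod m r \<in> carrier (FS1 m)"
  unfolding FS1_prod_def by (rule foldr_mult_closed) (auto simp: group_FS1 FS1_gen_closed)

lemma FS1_prod_0: "FS1_prod m 0 = \<one>\<^bsub>FS1 m\<^esub>"
  by (simp add: FS1_prod_def)

lemma FS1_prod_Suc:
  assumes "r < m"
  shows "FS1_prod m (Suc r) = FS1_prod m r \<otimes>\<^bsub>FS1 m\<^esub> FS1_y m (int r)"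
proof -
  interpret F: group "FS1 m" by (rule group_FS1)
  have split: "[0..int (Suc r) - 1] = [0..int r - 1] @ [int r]"
    by (simp add: upto_rec2)
  show ?thesis
    unfolding FS1_prod_def split using assms
    by (subst foldr_mult_append[OF group_FS1]) (auto simp: FS1_gen_closed FS1_y_nonneg)
qed

lemma FS1_prod_1: "0 < m \<Longrightarrow> FS1_prod m (Suc 0) = FS1_y m 0"
proof -
  interpret F: group "FS1 m" by (rule group_FS1)
  show "0 < m \<Longrightarrow> FS1_prod m (Suc 0) = FS1_y m 0"
    by (simp add: FS1_prod_Suc FS1_prod_0 FS1_y_closed)
qed

lemma FS1_y_minus: "FS1_y m (- 1) = inv\<^bsub>FS1 m\<^esub> FS1_prod m m"
  by (simp add: FS1_y_def FS1_prod_def)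

section \<open>Faces and degeneracies on the letter of index -1\<close>

lemma group_hom_FS1: "h \<in> hom (FS1 m) (FS1 l) \<Longrightarrow> group_hom (FS1 m) (FS1 l) h"
  by (simp add: group_hom_def group_hom_axioms_def group_FS1)

lemma FS1_face_y_nonneg:
  assumes "0 \<le> j" "j \<le> int n + 1" "0 \<le> i" "i \<le> int n"
  shows "FS1_face n j (FS1_y (n + 1) i) =
    (if j \<le> i then FS1_y n (i - 1) else if j = i + 1 then \<one>\<^bsub>FS1 n\<^esub> else FS1_y n i)"
proof -
  interpret F: group "FS1 n" by (rule group_FS1)
  show ?thesis
    unfolding FS1_face_def FS1_y_nonneg[OF assms(3), of "n + 1"]
    by (rule free_lift_gen[OF group_FS1]) (use assms in \<open>auto intro!: FS1_y_closed\<close>)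
qed

lemma FS1_degen_y_nonneg:
  assumes "0 \<le> j" "j \<le> int n + 1" "0 \<le> i" "i \<le> int n"
  shows "FS1_degen n j (FS1_y (n + 1) i) =
    (if j \<le> i then FS1_y (n + 2) (i + 1)
     else if j = i + 1 then FS1_y (n + 2) i \<otimes>\<^bsub>FS1 (n + 2)\<^esub> FS1_y (n + 2) (i + 1)
     else FS1_y (n + 2) i)"
proof -
  interpret F: group "FS1 (n + 2)" by (rule group_FS1)
  have Y: "FS1_y (n + 2) l \<in> carrier (FS1 (n + 2))" if "0 \<le> l" "l \<le> int n + 1" for l
    using that by (intro FS1_y_closed) auto
  show ?thesis
    unfolding FS1_degen_def FS1_y_nonneg[OF assms(3), of "n + 1"]
    by (rule free_lift_gen[OF group_FS1])
      (use assms in \<open>auto simp del: add_2_eq_Suc' intro!: Y F.m_closed\<close>)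
qed

text \<open>
  The letter \<open>y\<^sub>j\<^sub>-\<^sub>1\<close> is killed and the later ones move down by one, so a product of consecutive
  generators stays one, shorter by one factor if it contains \<open>y\<^sub>j\<^sub>-\<^sub>1\<close>.
\<close>

lemma FS1_face_prod:
  assumes "0 < j" "j \<le> n + 1" "r \<le> n + 1"
  shows "FS1_face n (int j) (FS1_prod (n + 1) r) = FS1_prod n (if r < j then r else r - 1)"
proof -
  interpret F: group "FS1 n" by (rule group_FS1)
  interpret d: group_hom "FS1 (n + 1)" "FS1 n" "FS1_face n (int j)"
    using assms by (intro group_hom_FS1 FS1_face_hom) auto
  show ?thesis using assms(3)
  proof (induction r)
    case 0
    then show ?case using assms d.hom_one by (simp add: FS1_prod_0)
  next
    case (Suc r)
    have "FS1_face n (int j) (FS1_prod (n + 1) (Suc r)) =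
        FS1_prod n (if r < j then r else r - 1) \<otimes>\<^bsub>FS1 n\<^esub> FS1_face n (int j) (FS1_y (n + 1) (int r))"
      using Suc by (simp only: FS1_prod_Suc)
        (simp add: d.hom_mult[simplified] FS1_prod_closed FS1_y_closed)
    also have "\<dots> = FS1_prod n (if Suc r < j then Suc r else Suc r - 1)"
    proof -
      consider "Suc r < j" | "j = Suc r" | "j \<le> r" by linarith
      then show ?thesis
      proof cases
        case 1
        then show ?thesis using assms Suc.prems FS1_face_y_nonneg[of "int j" n "int r"]
          by (simp add: FS1_prod_Suc)
      next
        case 2
        then show ?thesis using assms Suc.prems FS1_face_y_nonneg[of "int j" n "int r"]
          by (simp add: FS1_prod_closed add.commute)
      next
        case 3
        then obtain q where "r = Suc q" using assms by (cases r) auto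
        then show ?thesis using 3 assms Suc.prems FS1_face_y_nonneg[of "int j" n "int r"]
          by (simp add: FS1_prod_Suc)
      qed
    qed
    finally show ?case .
  qed
qed

text \<open>The extra factor is the image of \<open>y\<^sub>0\<close>, whose index drops to \<open>-1\<close>.\<close>

lemma FS1_face_0_prod:
  assumes "r \<le> n"
  shows "FS1_face n 0 (FS1_prod (n + 1) (Suc r)) = FS1_y n (- 1) \<otimes>\<^bsub>FS1 n\<^esub> FS1_prod n r"
proof -
  interpret F: group "FS1 n" by (rule group_FS1)
  interpret d: group_hom "FS1 (n + 1)" "FS1 n" "FS1_face n 0"
    by (intro group_hom_FS1 FS1_face_hom) auto
  show ?thesis using assms
  proof (induction r)
    case 0
    then show ?case using FS1_face_y_nonneg[of 0 n 0]
      by (simp add: FS1_prod_0 FS1_prod_1 FS1_y_closed)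
  next
    case (Suc r)
    have "FS1_face n 0 (FS1_prod (n + 1) (Suc (Suc r))) =
        FS1_face n 0 (FS1_prod (n + 1) (Suc r)) \<otimes>\<^bsub>FS1 n\<^esub> FS1_face n 0 (FS1_y (n + 1) (int (Suc r)))"
      using Suc.prems FS1_prod_Suc[of "Suc r" "n + 1"]
      by (simp add: d.hom_mult[simplified] FS1_prod_closed FS1_y_closed)
    then show ?case using Suc FS1_face_y_nonneg[of 0 n "int (Suc r)"]
      by (simp add: FS1_prod_Suc FS1_prod_closed FS1_y_closed F.m_assoc)
  qed
qed

text \<open>
  The letter \<open>y\<^sub>j\<^sub>-\<^sub>1\<close> becomes \<open>y\<^sub>j\<^sub>-\<^sub>1 y\<^sub>j\<close> and the later ones move up by one, so a product that contains
  \<open>y\<^sub>j\<^sub>-\<^sub>1\<close> stays a product of consecutive generators, with one more factor.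
\<close>

lemma FS1_degen_prod:
  assumes "0 < j" "j \<le> n + 1" "r \<le> n + 1"
  shows "FS1_degen n (int j) (FS1_prod (n + 1) r) = FS1_prod (n + 2) (if r < j then r else Suc r)"
proof -
  \<comment> \<open>An opaque name, since the simplifier rewrites \<open>n + 2\<close> to \<open>Suc (Suc n)\<close> inside \<open>FS1 (n + 2)\<close>.\<close>
  define N where "N = n + 2"
  interpret F: group "FS1 N" by (rule group_FS1)
  interpret s: group_hom "FS1 (n + 1)" "FS1 N" "FS1_degen n (int j)"
    unfolding N_def using assms by (intro group_hom_FS1 FS1_degen_hom) auto
  note sy = FS1_degen_y_nonneg[of _ n, folded N_def]
  have "FS1_degen n (int j) (FS1_prod (n + 1) r) = FS1_prod N (if r < j then r else Suc r)"
    using assms(3)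
  proof (induction r)
    case 0
    then show ?case using assms s.hom_one by (simp add: FS1_prod_0)
  next
    case (Suc r)
    have "FS1_degen n (int j) (FS1_prod (n + 1) (Suc r)) =
        FS1_prod N (if r < j then r else Suc r) \<otimes>\<^bsub>FS1 N\<^esub> FS1_degen n (int j) (FS1_y (n + 1) (int r))"
      using Suc by (simp only: FS1_prod_Suc)
        (simp add: s.hom_mult[simplified] FS1_prod_closed FS1_y_closed)
    also have "\<dots> = FS1_prod N (if Suc r < j then Suc r else Suc (Suc r))"
    proof -
      consider "Suc r < j" | "j = Suc r" | "j \<le> r" by linarith
      then show ?thesis
      proof cases
        case 1
        then show ?thesis using assms Suc.prems sy[of "int j" "int r"]
          by (simp add: FS1_prod_Suc N_def)
      next
        case 2
        have rN: "r < N" "Suc r < N" using Suc.prems by (auto simp: N_def)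
        have "FS1_prod N r \<in> carrier (FS1 N)" "FS1_y N (int r) \<in> carrier (FS1 N)"
          "FS1_y N (int (Suc r)) \<in> carrier (FS1 N)"
          using Suc.prems by (auto simp: N_def intro: FS1_prod_closed FS1_y_closed)
        then show ?thesis using 2 assms Suc.prems sy[of "int j" "int r"]
            FS1_prod_Suc[OF rN(1)] FS1_prod_Suc[OF rN(2)]
          by (simp add: F.m_assoc add.commute)
      next
        case 3
        then show ?thesis using assms Suc.prems sy[of "int j" "int r"]
            FS1_prod_Suc[of "Suc r" N]
          by (simp add: N_def add.commute)
      qed
    qed
    finally show ?case .
  qed
  then show ?thesis by (simp add: N_def)
qed

text \<open>All indices are raised by one, so the first factor \<open>y\<^sub>0\<close> has to be cancelled.\<close>

lemma FS1_degen_0_prod: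
  assumes "r \<le> n + 1"
  shows "FS1_degen n 0 (FS1_prod (n + 1) r) =
    inv\<^bsub>FS1 (n + 2)\<^esub> FS1_y (n + 2) 0 \<otimes>\<^bsub>FS1 (n + 2)\<^esub> FS1_prod (n + 2) (Suc r)"
proof -
  define N where "N = n + 2"
  interpret F: group "FS1 N" by (rule group_FS1)
  interpret s: group_hom "FS1 (n + 1)" "FS1 N" "FS1_degen n 0"
    unfolding N_def by (intro group_hom_FS1 FS1_degen_hom) auto
  have y0: "FS1_y N 0 \<in> carrier (FS1 N)" by (rule FS1_y_closed) (auto simp: N_def)
  have "FS1_degen n 0 (FS1_prod (n + 1) r) = inv\<^bsub>FS1 N\<^esub> FS1_y N 0 \<otimes>\<^bsub>FS1 N\<^esub> FS1_prod N (Suc r)"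
    using assms
  proof (induction r)
    case 0
    have "0 < N" by (simp add: N_def)
    then show ?case using s.hom_one y0 by (simp add: FS1_prod_0 FS1_prod_1)
  next
    case (Suc r)
    have c: "FS1_prod N (Suc r) \<in> carrier (FS1 N)" "FS1_y N (int (Suc r)) \<in> carrier (FS1 N)"
      using Suc.prems by (auto simp: N_def intro: FS1_prod_closed FS1_y_closed)
    have rN: "Suc r < N" using Suc.prems by (simp add: N_def)
    have "FS1_degen n 0 (FS1_prod (n + 1) (Suc r)) =
        FS1_degen n 0 (FS1_prod (n + 1) r) \<otimes>\<^bsub>FS1 N\<^esub> FS1_degen n 0 (FS1_y (n + 1) (int r))"
      using Suc.prems FS1_prod_Suc[of r "n + 1"]
      by (simp add: s.hom_mult[simplified] FS1_prod_closed FS1_y_closed)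
    also have "FS1_degen n 0 (FS1_y (n + 1) (int r)) = FS1_y N (int (Suc r))"
      using Suc.prems FS1_degen_y_nonneg[of 0 n "int r"] by (simp add: N_def add.commute)
    also have "FS1_degen n 0 (FS1_prod (n + 1) r) =
        inv\<^bsub>FS1 N\<^esub> FS1_y N 0 \<otimes>\<^bsub>FS1 N\<^esub> FS1_prod N (Suc r)"
      using Suc by simp
    also have "\<dots> \<otimes>\<^bsub>FS1 N\<^esub> FS1_y N (int (Suc r)) =
        inv\<^bsub>FS1 N\<^esub> FS1_y N 0 \<otimes>\<^bsub>FS1 N\<^esub> FS1_prod N (Suc (Suc r))"
      using c y0 rN by (simp add: FS1_prod_Suc[of "Suc r"] F.m_assoc)
    finally show ?case .
  qed
  then show ?thesis by (simp add: N_def)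
qed

text \<open>
  For \<open>i = -1\<close> invert the image of the full product. If \<open>j > 0\<close>, that image is again the full
  product; if \<open>j = 0\<close>, it is \<open>y\<^sub>-\<^sub>1\<close> times the full product, which is trivial.
\<close>

lemma FS1_face_y:
  assumes j: "0 \<le> j" "j \<le> int n + 1" and i: "- 1 \<le> i" "i \<le> int n"
  shows "FS1_face n j (FS1_y (n + 1) i) =
    (if j \<le> i then FS1_y n (i - 1) else if j = i + 1 then \<one>\<^bsub>FS1 n\<^esub> else FS1_y n i)"
proof (cases "i = - 1")
  case True
  interpret F: group "FS1 n" by (rule group_FS1)
  interpret d: group_hom "FS1 (n + 1)" "FS1 n" "FS1_face n j"
    using j by (intro group_hom_FS1 FS1_face_hom)
  have "FS1_face n j (FS1_y (n + 1) (- 1)) = inv\<^bsub>FS1 n\<^esub> FS1_face n j (FS1_prod (n + 1) (n + 1))"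
    unfolding FS1_y_minus by (rule d.hom_inv) (simp add: FS1_prod_closed)
  also have "\<dots> = (if j = 0 then \<one>\<^bsub>FS1 n\<^esub> else FS1_y n (- 1))"
  proof (cases "j = 0")
    case True
    then show ?thesis using FS1_face_0_prod[of n n]
      by (simp add: FS1_y_minus FS1_prod_closed)
  next
    case False
    then show ?thesis using j FS1_face_prod[of "nat j" n "n + 1"]
      by (auto simp: FS1_y_minus)
  qed
  finally show ?thesis using True j by auto
next
  case False
  then show ?thesis using FS1_face_y_nonneg[OF j] i by simp
qed

text \<open>
  For \<open>i = -1\<close> and \<open>j = 0\<close> the full product goes to \<open>y\<^sub>0\<^sup>-\<^sup>1\<close> times the full product, whose inverse is
  \<open>y\<^sub>-\<^sub>1 y\<^sub>0\<close>.
\<close>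

lemma FS1_degen_y:
  assumes j: "0 \<le> j" "j \<le> int n + 1" and i: "- 1 \<le> i" "i \<le> int n"
  shows "FS1_degen n j (FS1_y (n + 1) i) =
    (if j \<le> i then FS1_y (n + 2) (i + 1)
     else if j = i + 1 then FS1_y (n + 2) i \<otimes>\<^bsub>FS1 (n + 2)\<^esub> FS1_y (n + 2) (i + 1)
     else FS1_y (n + 2) i)"
proof (cases "i = - 1")
  case True
  define N where "N = n + 2"
  interpret F: group "FS1 N" by (rule group_FS1)
  interpret s: group_hom "FS1 (n + 1)" "FS1 N" "FS1_degen n j"
    unfolding N_def using j by (intro group_hom_FS1 FS1_degen_hom)
  have N: "Suc (n + 1) = N" by (simp add: N_def)
  have c: "FS1_prod N N \<in> carrier (FS1 N)" "FS1_y N 0 \<in> carrier (FS1 N)"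
    by (auto simp: N_def intro!: FS1_prod_closed FS1_y_closed)
  have "FS1_degen n j (FS1_y (n + 1) (- 1)) = inv\<^bsub>FS1 N\<^esub> FS1_degen n j (FS1_prod (n + 1) (n + 1))"
    unfolding FS1_y_minus by (rule s.hom_inv) (simp add: FS1_prod_closed)
  also have "\<dots> = (if j = 0 then FS1_y N (- 1) \<otimes>\<^bsub>FS1 N\<^esub> FS1_y N 0 else FS1_y N (- 1))"
  proof (cases "j = 0")
    case True
    then have "FS1_degen n j (FS1_prod (n + 1) (n + 1)) =
        inv\<^bsub>FS1 N\<^esub> FS1_y N 0 \<otimes>\<^bsub>FS1 N\<^esub> FS1_prod N N"
      using FS1_degen_0_prod[of "n + 1" n, folded N_def, unfolded N] by simp
    then show ?thesis using True c by (simp add: FS1_y_minus F.inv_mult_group)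
  next
    case False
    then have "FS1_degen n j (FS1_prod (n + 1) (n + 1)) = FS1_prod N N"
      using j FS1_degen_prod[of "nat j" n "n + 1", folded N_def, unfolded N] by auto
    then show ?thesis using False by (simp add: FS1_y_minus)
  qed
  finally show ?thesis using True j by (auto simp: N_def)
next
  case False
  then show ?thesis using FS1_degen_y_nonneg[OF j] i by simp
qed

section \<open>Commutation with the braid automorphisms\<close>

lemma FS1_hom_eqI:
  assumes "h \<in> hom (FS1 m) (FS1 l)" "h' \<in> hom (FS1 m) (FS1 l)"
    and "\<And>i. 0 \<le> i \<Longrightarrow> i < int m \<Longrightarrow> h (FS1_y m i) = h' (FS1_y m i)"
    and "x \<in> carrier (FS1 m)"
  shows "h x = h' x"
  using assms free_group_hom_ext[OF group_FS1[of l], of h "{0..int m - 1}" h' x]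
  by (simp add: FS1_def[of m] FS1_y_nonneg)

text \<open>
  The letters \<open>y\<^sub>k\<close>, \<open>y\<^sub>k\<^sub>+\<^sub>1\<close> are sent by \<open>\<sigma>\<^sub>k\<close> to \<open>y\<^sub>k\<^sub>+\<^sub>1\<close> and a conjugate of \<open>y\<^sub>k\<close>. If \<open>d\<^sub>j\<close> kills \<open>y\<^sub>k\<^sub>+\<^sub>1\<close>, the
  conjugation disappears; if it kills \<open>y\<^sub>k\<close>, the conjugate is trivial. Either way what remains is
  the face that kills the other letter.
\<close>

lemma FS1_face_sigma:
  assumes k: "- 1 \<le> k" "k \<le> int n - 1" and j: "0 \<le> j" "j \<le> int n + 1"
    and x: "x \<in> carrier (FS1 (n + 1))"
  shows "FS1_face n j (FS1_sigma (n + 1) k x) =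
    (if j \<le> k then FS1_sigma n (k - 1) (FS1_face n j x)
     else if j = k + 1 then FS1_face n (k + 2) x
     else if j = k + 2 then FS1_face n (k + 1) x
     else FS1_sigma n k (FS1_face n j x))"
proof -
  define M where "M = n + 1"
  have M: "int M = int n + 1" by (simp add: M_def)
  interpret F: group "FS1 n" by (rule group_FS1)
  have d: "FS1_face n l \<in> hom (FS1 M) (FS1 n)" if "0 \<le> l" "l \<le> int n + 1" for l
    using FS1_face_hom[OF that] by (simp add: M_def)
  interpret d: group_hom "FS1 M" "FS1 n" "FS1_face n j"
    using j by (intro group_hom_FS1 d)
  have dy: "FS1_face n l (FS1_y M i) =
      (if l \<le> i then FS1_y n (i - 1) else if l = i + 1 then \<one>\<^bsub>FS1 n\<^esub> else FS1_y n i)"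
    if "0 \<le> l" "l \<le> int n + 1" "- 1 \<le> i" "i \<le> int n" for l i
    using FS1_face_y[OF that] by (simp add: M_def)
  have kM: "k \<le> int M - 2" using k M by simp
  note s = FS1_sigma_y(1)[OF k(1) kM] and sy = FS1_sigma_y(2)[OF k(1) kM]
  have Y: "FS1_y M i \<in> carrier (FS1 M)" if "- 1 \<le> i" "i \<le> int n" for i
    using that M by (intro FS1_y_closed) auto
  have Z: "FS1_y n i \<in> carrier (FS1 n)" if "- 1 \<le> i" "i < int n" for i
    using that by (rule FS1_y_closed)
  have ds: "FS1_face n j \<circ> FS1_sigma M k \<in> hom (FS1 M) (FS1 n)"
    using s d[OF j] by (rule hom_compose)
  have dsy: "FS1_face n j (FS1_sigma M k (FS1_y M i)) =
      (if i = k then FS1_face n j (FS1_y M (k + 1))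
       else if i = k + 1
       then inv\<^bsub>FS1 n\<^esub> FS1_face n j (FS1_y M (k + 1)) \<otimes>\<^bsub>FS1 n\<^esub> FS1_face n j (FS1_y M k)
         \<otimes>\<^bsub>FS1 n\<^esub> FS1_face n j (FS1_y M (k + 1))
       else FS1_face n j (FS1_y M i))" if "0 \<le> i" "i < int M" for i
    using that k M Y by (simp add: sy)
  note eqI = FS1_hom_eqI[OF ds, unfolded o_apply, OF _ _ x[folded M_def]]
  consider (below) "j \<le> k" | (left) "j = k + 1" | (right) "j = k + 2" | (above) "j > k + 2"
    by linarith
  then have "FS1_face n j (FS1_sigma M k x) =
    (if j \<le> k then FS1_sigma n (k - 1) (FS1_face n j x)
     else if j = k + 1 then FS1_face n (k + 2) x
     else if j = k + 2 then FS1_face n (k + 1) x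
     else FS1_sigma n k (FS1_face n j x))"
  proof cases
    case below
    then have k': "- 1 \<le> k - 1" "k - 1 \<le> int n - 2" using k j by auto
    interpret t: group_hom "FS1 n" "FS1 n" "FS1_sigma n (k - 1)"
      using FS1_sigma_y(1)[OF k'] by (rule group_hom_FS1)
    note ty = FS1_sigma_y(2)[OF k']
    have "FS1_face n j (FS1_sigma M k x) = (FS1_sigma n (k - 1) \<circ> FS1_face n j) x"
    proof (rule eqI)
      show "FS1_sigma n (k - 1) \<circ> FS1_face n j \<in> hom (FS1 M) (FS1 n)"
        using d[OF j] t.homh by (rule hom_compose)
    next
      fix i assume i: "0 \<le> i" "i < int M"
      show "FS1_face n j (FS1_sigma M k (FS1_y M i)) = (FS1_sigma n (k - 1) \<circ> FS1_face n j) (FS1_y M i)"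
        using i M j k below Z by (auto simp: dsy dy ty)
    qed
    then show ?thesis using below by simp
  next
    case left
    have "FS1_face n j (FS1_sigma M k x) = FS1_face n (k + 2) x"
    proof (rule eqI)
      show "FS1_face n (k + 2) \<in> hom (FS1 M) (FS1 n)" using k by (intro d) auto
    next
      fix i assume i: "0 \<le> i" "i < int M"
      show "FS1_face n j (FS1_sigma M k (FS1_y M i)) = FS1_face n (k + 2) (FS1_y M i)"
        unfolding dsy[OF i] using i M j k left Z by (auto simp: dy)
    qed
    then show ?thesis using left by simp
  next
    case right
    have "FS1_face n j (FS1_sigma M k x) = FS1_face n (k + 1) x"
    proof (rule eqI)
      show "FS1_face n (k + 1) \<in> hom (FS1 M) (FS1 n)" using k by (intro d) auto
    next
      fix i assume i: "0 \<le> i" "i < int M"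
      show "FS1_face n j (FS1_sigma M k (FS1_y M i)) = FS1_face n (k + 1) (FS1_y M i)"
        unfolding dsy[OF i] using i M j k right Z by (auto simp: dy)
    qed
    then show ?thesis using right by simp
  next
    case above
    then have k': "k \<le> int n - 2" using j by auto
    interpret t: group_hom "FS1 n" "FS1 n" "FS1_sigma n k"
      using FS1_sigma_y(1)[OF k(1) k'] by (rule group_hom_FS1)
    note ty = FS1_sigma_y(2)[OF k(1) k']
    have "FS1_face n j (FS1_sigma M k x) = (FS1_sigma n k \<circ> FS1_face n j) x"
    proof (rule eqI)
      show "FS1_sigma n k \<circ> FS1_face n j \<in> hom (FS1 M) (FS1 n)"
        using d[OF j] t.homh by (rule hom_compose)
    next
      fix i assume i: "0 \<le> i" "i < int M"
      show "FS1_face n j (FS1_sigma M k (FS1_y M i)) = (FS1_sigma n k \<circ> FS1_face n j) (FS1_y M i)"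
        using i M j k above Z by (auto simp: dsy dy ty)
    qed
    then show ?thesis using above by simp
  qed
  then show ?thesis by (simp add: M_def)
qed

text \<open>
  For \<open>j = k + 1\<close> the two words to compare on \<open>y\<^sub>k\<^sub>+\<^sub>1\<close> both equal
  \<open>y\<^sub>k\<^sub>+\<^sub>2\<^sup>-\<^sup>1 y\<^sub>k y\<^sub>k\<^sub>+\<^sub>1 y\<^sub>k\<^sub>+\<^sub>2\<close>; for \<open>j = k + 2\<close> they both equal
  \<open>y\<^sub>k\<^sub>+\<^sub>2\<^sup>-\<^sup>1 y\<^sub>k\<^sub>+\<^sub>1\<^sup>-\<^sup>1 y\<^sub>k y\<^sub>k\<^sub>+\<^sub>1 y\<^sub>k\<^sub>+\<^sub>2\<close>.
\<close>

lemma FS1_degen_sigma: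
  assumes k: "- 1 \<le> k" "k \<le> int n - 1" and j: "0 \<le> j" "j \<le> int n + 1"
    and x: "x \<in> carrier (FS1 (n + 1))"
  shows "FS1_degen n j (FS1_sigma (n + 1) k x) =
    (if j \<le> k then FS1_sigma (n + 2) (k + 1) (FS1_degen n j x)
     else if j = k + 1
     then FS1_sigma (n + 2) (k + 1) (FS1_sigma (n + 2) k (FS1_degen n (k + 2) x))
     else if j = k + 2
     then FS1_sigma (n + 2) k (FS1_sigma (n + 2) (k + 1) (FS1_degen n (k + 1) x))
     else FS1_sigma (n + 2) k (FS1_degen n j x))"
proof -
  define M N where "M = n + 1" and "N = n + 2"
  have M: "int M = int n + 1" and N: "int N = int n + 2" by (simp_all add: M_def N_def)
  interpret F: group "FS1 N" by (rule group_FS1)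
  have d: "FS1_degen n l \<in> hom (FS1 M) (FS1 N)" if "0 \<le> l" "l \<le> int n + 1" for l
    using FS1_degen_hom[OF that] by (simp add: M_def N_def)
  interpret d: group_hom "FS1 M" "FS1 N" "FS1_degen n j"
    using j by (intro group_hom_FS1 d)
  have dy: "FS1_degen n l (FS1_y M i) =
      (if l \<le> i then FS1_y N (i + 1)
       else if l = i + 1 then FS1_y N i \<otimes>\<^bsub>FS1 N\<^esub> FS1_y N (i + 1)
       else FS1_y N i)"
    if "0 \<le> l" "l \<le> int n + 1" "- 1 \<le> i" "i \<le> int n" for l i
    using FS1_degen_y[OF that] by (simp add: M_def N_def)
  have kM: "k \<le> int M - 2" and kN: "k \<le> int N - 2" "- 1 \<le> k + 1" "k + 1 \<le> int N - 2"
    using k M N by auto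
  note s = FS1_sigma_y(1)[OF k(1) kM] and sy = FS1_sigma_y(2)[OF k(1) kM]
  interpret t: group_hom "FS1 N" "FS1 N" "FS1_sigma N k"
    using FS1_sigma_y(1)[OF k(1) kN(1)] by (rule group_hom_FS1)
  interpret u: group_hom "FS1 N" "FS1 N" "FS1_sigma N (k + 1)"
    using FS1_sigma_y(1)[OF kN(2,3)] by (rule group_hom_FS1)
  note ty = FS1_sigma_y(2)[OF k(1) kN(1)] and uy = FS1_sigma_y(2)[OF kN(2,3)]
  have Y: "FS1_y M i \<in> carrier (FS1 M)" if "- 1 \<le> i" "i \<le> int n" for i
    using that M by (intro FS1_y_closed) auto
  have Z: "FS1_y N i \<in> carrier (FS1 N)" if "- 1 \<le> i" "i \<le> int n + 1" for i
    using that N by (intro FS1_y_closed) auto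
  have ds: "FS1_degen n j \<circ> FS1_sigma M k \<in> hom (FS1 M) (FS1 N)"
    using s d[OF j] by (rule hom_compose)
  have dsy: "FS1_degen n j (FS1_sigma M k (FS1_y M i)) =
      (if i = k then FS1_degen n j (FS1_y M (k + 1))
       else if i = k + 1
       then inv\<^bsub>FS1 N\<^esub> FS1_degen n j (FS1_y M (k + 1)) \<otimes>\<^bsub>FS1 N\<^esub> FS1_degen n j (FS1_y M k)
         \<otimes>\<^bsub>FS1 N\<^esub> FS1_degen n j (FS1_y M (k + 1))
       else FS1_degen n j (FS1_y M i))" if "0 \<le> i" "i < int M" for i
    using that k M Y by (simp add: sy)
  note eqI = FS1_hom_eqI[OF ds, unfolded o_apply, OF _ _ x[folded M_def]]
  consider (below) "j \<le> k" | (left) "j = k + 1" | (right) "j = k + 2" | (above) "j > k + 2"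
    by linarith
  then have "FS1_degen n j (FS1_sigma M k x) =
    (if j \<le> k then FS1_sigma N (k + 1) (FS1_degen n j x)
     else if j = k + 1
     then FS1_sigma N (k + 1) (FS1_sigma N k (FS1_degen n (k + 2) x))
     else if j = k + 2
     then FS1_sigma N k (FS1_sigma N (k + 1) (FS1_degen n (k + 1) x))
     else FS1_sigma N k (FS1_degen n j x))"
  proof cases
    case below
    have "FS1_degen n j (FS1_sigma M k x) = (FS1_sigma N (k + 1) \<circ> FS1_degen n j) x"
    proof (rule eqI)
      show "FS1_sigma N (k + 1) \<circ> FS1_degen n j \<in> hom (FS1 M) (FS1 N)"
        using d[OF j] u.homh by (rule hom_compose)
    next
      fix i assume i: "0 \<le> i" "i < int M"
      show "FS1_degen n j (FS1_sigma M k (FS1_y M i)) =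
          (FS1_sigma N (k + 1) \<circ> FS1_degen n j) (FS1_y M i)"
        using i M N j k below Z by (auto simp: dsy dy uy)
    qed
    then show ?thesis using below by simp
  next
    case left
    have e: "FS1_degen n (k + 2) \<in> hom (FS1 M) (FS1 N)" using k by (intro d) auto
    have "FS1_degen n j (FS1_sigma M k x) =
        (FS1_sigma N (k + 1) \<circ> (FS1_sigma N k \<circ> FS1_degen n (k + 2))) x"
    proof (rule eqI)
      show "FS1_sigma N (k + 1) \<circ> (FS1_sigma N k \<circ> FS1_degen n (k + 2)) \<in> hom (FS1 M) (FS1 N)"
        using hom_compose[OF hom_compose[OF e t.homh] u.homh] .
    next
      fix i assume i: "0 \<le> i" "i < int M"
      show "FS1_degen n j (FS1_sigma M k (FS1_y M i)) =
          (FS1_sigma N (k + 1) \<circ> (FS1_sigma N k \<circ> FS1_degen n (k + 2))) (FS1_y M i)"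
        unfolding dsy[OF i] using i M N j k left Z by (auto simp: dy ty uy F.m_assoc F.mult_inv_cancel)
    qed
    then show ?thesis using left by simp
  next
    case right
    have e: "FS1_degen n (k + 1) \<in> hom (FS1 M) (FS1 N)" using k by (intro d) auto
    have "FS1_degen n j (FS1_sigma M k x) =
        (FS1_sigma N k \<circ> (FS1_sigma N (k + 1) \<circ> FS1_degen n (k + 1))) x"
    proof (rule eqI)
      show "FS1_sigma N k \<circ> (FS1_sigma N (k + 1) \<circ> FS1_degen n (k + 1)) \<in> hom (FS1 M) (FS1 N)"
        using hom_compose[OF hom_compose[OF e u.homh] t.homh] .
    next
      fix i assume i: "0 \<le> i" "i < int M"
      show "FS1_degen n j (FS1_sigma M k (FS1_y M i)) =
          (FS1_sigma N k \<circ> (FS1_sigma N (k + 1) \<circ> FS1_degen n (k + 1))) (FS1_y M i)"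
        unfolding dsy[OF i] using i M N j k right Z
        by (auto simp: dy ty uy F.m_assoc F.inv_mult_group F.mult_inv_cancel)
    qed
    then show ?thesis using right by simp
  next
    case above
    have "FS1_degen n j (FS1_sigma M k x) = (FS1_sigma N k \<circ> FS1_degen n j) x"
    proof (rule eqI)
      show "FS1_sigma N k \<circ> FS1_degen n j \<in> hom (FS1 M) (FS1 N)"
        using d[OF j] t.homh by (rule hom_compose)
    next
      fix i assume i: "0 \<le> i" "i < int M"
      show "FS1_degen n j (FS1_sigma M k (FS1_y M i)) = (FS1_sigma N k \<circ> FS1_degen n j) (FS1_y M i)"
        using i M N j k above Z by (auto simp: dsy dy ty)
    qed
    then show ?thesis using above by simp
  qed
  then show ?thesis by (simp add: M_def N_def)
qed

theorem proposition2p1: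
  fixes n :: nat and k j :: int
  assumes "- 1 \<le> k" "k \<le> int n - 1" "0 \<le> j" "j \<le> int n + 1"
  shows "\<forall>x\<in>carrier (FS1 (n + 1)).
      FS1_face n j (braid_action (n + 1) (braid_gen (n + 2) k) x) =
        (if j \<le> k then braid_action n (braid_gen (n + 1) (k - 1)) (FS1_face n j x)
         else if j = k + 1 then FS1_face n (k + 2) x
         else if j = k + 2 then FS1_face n (k + 1) x
         else braid_action n (braid_gen (n + 1) k) (FS1_face n j x))
    \<and> FS1_degen n j (braid_action (n + 1) (braid_gen (n + 2) k) x) =
        (if j \<le> k
         then braid_action (n + 2) (braid_gen (n + 3) (k + 1)) (FS1_degen n j x)
         else if j = k + 1
         then braid_action (n + 2) (braid_gen (n + 3) (k + 1))
           (braid_action (n + 2) (braid_gen (n + 3) k) (FS1_degen n (k + 2) x))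
         else if j = k + 2
         then braid_action (n + 2) (braid_gen (n + 3) k)
           (braid_action (n + 2) (braid_gen (n + 3) (k + 1)) (FS1_degen n (k + 1) x))
         else braid_action (n + 2) (braid_gen (n + 3) k) (FS1_degen n j x))"
proof -
  have s: "braid_action (n + 1) (braid_gen (n + 2) k) = FS1_sigma (n + 1) k"
    using braid_action_gen[of k "n + 1"] assms by simp
  have t: "braid_action (n + 2) (braid_gen (n + 3) k) = FS1_sigma (n + 2) k"
    and u: "braid_action (n + 2) (braid_gen (n + 3) (k + 1)) = FS1_sigma (n + 2) (k + 1)"
    using braid_action_gen[of k "n + 2"] braid_action_gen[of "k + 1" "n + 2"] assms
    by (simp_all add: numeral_3_eq_3)
  have below: "braid_action n (braid_gen (n + 1) (k - 1)) = FS1_sigma n (k - 1)" if "j \<le> k"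
    using braid_action_gen[of "k - 1" n] assms that by simp
  have above: "braid_action n (braid_gen (n + 1) k) = FS1_sigma n k" if "k + 2 < j"
    using braid_action_gen[of k n] assms that by simp
  show ?thesis
    unfolding s t u using FS1_face_sigma[OF assms] FS1_degen_sigma[OF assms] below above
    by (cases "j \<le> k"; cases "k + 2 < j") auto
qed

end
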